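(* Let $(\mathcal A,\mathcal A_0,(-))$ be a metatangible pair of the second kind with a negation map $(-)$. If $b_1,b_2\in\mathcal A$ satisfy $b_1\,\nabla_{(-)}\,b_2$, then $b_1\,\nabla_T\,b_2$. Conversely, if $b_1\,\nabla_T\,b_2$ and $(\mathcal A,\mathcal A_0,(-))$ is uniquely negated, then $b_1\,\nabla_{(-)}\,b_2$.
   Context: Let $\mathcal T$ be a set with a distinguished element $1$. A left $\mathcal T$-module is a commutative additive semigroup $(\mathcal A,+,0)$ with zero element and a left action of $\mathcal T$ satisfying $a0=0$, $a(b_1+b_2)=ab_1+ab_2$, $1b=b$; right modules are analogous; a $\mathcal T$-bimodule is both, with $(a_1b)a_2=a_1(ba_2)$. Put $\mathcal T_0=\mathcal T\cup\{0\}$ ($0\notin\mathcal T$). $\mathcal A$ is weakly admissible if $\mathcal T_0\subseteq\mathcal A$ and the left and right actions of each $a\in\mathcal T$ on $1\in\mathcal A$ give $a$; it is admissible if moreover $\mathcal T_0$ spans $(\mathcal A,+)$. A pair $(\mathcal A,\mathcal A_0)$ is a $\mathcal T$-bimodule $\mathcal A$ with a sub-bimodule $\mathcal A_0$; it is (weakly) admissible if $\mathcal A$ is and $\mathcal A_0\cap\mathcal T_0=\{0\}$. Standing assumptions: all pairs are weakly admissible; for $a\in\mathcal T$, $b\in\mathcal A$, if $ab\in\mathcal A_0$ or $ba\in\mathcal A_0$ then $b\in\mathcal A_0$; and $ab_1=ab_2$ or $b_1a=b_2a$ implies $b_1=b_2$. Second kind: $a+a\notin\mathcal A_0$ for all $a\in\mathcal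 T$. Weak Property N: there is $1^\dag\in\mathcal T$ with $1+1^\dag\in\mathcal A_0$, $1^\dag\mathcal T\subseteq\mathcal T$, $1^\dag b=b1^\dag$ for all $b\in\mathcal A$; put $b^\dag=b1^\dag$, $b^\circ=b+b^\dag$. Property N: in addition, $a_1+a_2=a_1^\circ$ whenever $a_1,a_2\in\mathcal T$ and $a_1+a_2\in\mathcal A_0$. The pair is metatangible if it is admissible, satisfies Property N, and $a_1+a_2\in\mathcal T\cup\mathcal A_0$ for all $a_1,a_2\in\mathcal T$. A negation map on $(\mathcal A,\mathcal A_0)$ is a semigroup automorphism $(-)$ of $(\mathcal A,+,0)$ of order $\le2$, leaving $\mathcal T$ invariant, with $1+((-)1)\in\mathcal A_0$, and with $((-)a)b=(-)(ab)=a((-)b)$, $((-)b)a=(-)(ba)=b((-)a)$ for $a\in\mathcal T$, $b\in\mathcal A$. We write $b(-)b'$ for $b+((-)b')$. Uniquely negated: $a+a'\in\mathcal A_0$ with $a,a'\in\mathcal T$ implies $a'=(-)a$. Relations on $\mathcal A$: $b_1\,\nabla_{(-)}\,b_2$ means $b_1(-)b_2\in\mathcal A_0$. $b_1\,\nabla_T\,b_2$ means that for some $t\ge0$ we can write $b_i=b_{i,0}+\sum_{j=1}^t a_{i,j}$ ($i=1,2$) with $b_{i,0}\in\mathcal A_0$, $a_{i,j}\in\mathcal T$, such that for each $1\le j\le t$ there is $a_j\in\mathcal T$ with $a_{1,j}+a_j\in\mathcal A_0$ and $a_{2,j}+a_j\in\mathcal A_0$. *)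

theory Defs
  imports Main
begin

text \<open>
  The additive semigroup with zero is the whole type \<open>'a :: comm_monoid_add\<close>. The set \<open>T\<close> acts by
  total functions that are constrained only for scalars in \<open>T\<close>. No multiplication on \<open>T\<close>
  and no closure of \<open>T\<close> under the action is assumed.
\<close>

locale left_T_module =
  fixes T :: "'t set" and one :: 't
    and lact :: "'t \<Rightarrow> 'a::comm_monoid_add \<Rightarrow> 'a"  (infixr "\<rhd>" 75)
  assumes one_in_T: "one \<in> T"
    and lact_zero: "a \<in> T \<Longrightarrow> a \<rhd> 0 = 0"
    and lact_add: "a \<in> T \<Longrightarrow> a \<rhd> (b1 + b2) = a \<rhd> b1 + a \<rhd> b2"
    and lact_one: "one \<rhd> b = b"

locale right_T_module =
  fixes T :: "'t set" and one :: 't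
    and ract :: "'a::comm_monoid_add \<Rightarrow> 't \<Rightarrow> 'a"  (infixl "\<lhd>" 75)
  assumes one_in_T': "one \<in> T"
    and ract_zero: "a \<in> T \<Longrightarrow> 0 \<lhd> a = 0"
    and ract_add: "a \<in> T \<Longrightarrow> (b1 + b2) \<lhd> a = b1 \<lhd> a + b2 \<lhd> a"
    and ract_one: "b \<lhd> one = b"

locale T_bimodule =
  left_T_module T one lact + right_T_module T one ract
  for T :: "'t set" and one :: 't
    and lact :: "'t \<Rightarrow> 'a::comm_monoid_add \<Rightarrow> 'a"  (infixr "\<rhd>" 75)
    and ract :: "'a \<Rightarrow> 't \<Rightarrow> 'a"  (infixl "\<lhd>" 75) +
  assumes bimodule_assoc: "a1 \<in> T \<Longrightarrow> a2 \<in> T \<Longrightarrow> (a1 \<rhd> b) \<lhd> a2 = a1 \<rhd> (b \<lhd> a2)"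

locale T_pair =
  T_bimodule T one lact ract
  for T :: "'t set" and one :: 't
    and lact :: "'t \<Rightarrow> 'a::comm_monoid_add \<Rightarrow> 'a"  (infixr "\<rhd>" 75)
    and ract :: "'a \<Rightarrow> 't \<Rightarrow> 'a"  (infixl "\<lhd>" 75) +
  fixes A0 :: "'a set"
  assumes A0_zero: "0 \<in> A0"
    and A0_add: "x \<in> A0 \<Longrightarrow> y \<in> A0 \<Longrightarrow> x + y \<in> A0"
    and A0_lact: "a \<in> T \<Longrightarrow> x \<in> A0 \<Longrightarrow> a \<rhd> x \<in> A0"
    and A0_ract: "a \<in> T \<Longrightarrow> x \<in> A0 \<Longrightarrow> x \<lhd> a \<in> A0"

text \<open>From here on \<open>T\<close> is a subset of the module itself, so scalars have the module's type.\<close>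

locale weakly_admissible_pair =
  T_pair T one lact ract A0
  for T :: "'a::comm_monoid_add set" and one :: 'a
    and lact :: "'a \<Rightarrow> 'a \<Rightarrow> 'a"  (infixr "\<rhd>" 75)
    and ract :: "'a \<Rightarrow> 'a \<Rightarrow> 'a"  (infixl "\<lhd>" 75)
    and A0 :: "'a set" +
  assumes zero_notin_T: "0 \<notin> T"
    and lact_on_one: "a \<in> T \<Longrightarrow> a \<rhd> one = a"
    and ract_on_one: "a \<in> T \<Longrightarrow> one \<lhd> a = a"
    and A0_Int_T0: "A0 \<inter> insert 0 T = {0}"

locale standing_pair =
  weakly_admissible_pair T one lact ract A0
  for T :: "'a::comm_monoid_add set" and one :: 'a
    and lact :: "'a \<Rightarrow> 'a \<Rightarrow> 'a"  (infixr "\<rhd>" 75)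
    and ract :: "'a \<Rightarrow> 'a \<Rightarrow> 'a"  (infixl "\<lhd>" 75)
    and A0 :: "'a set" +
  assumes A0_lact_cancel: "a \<in> T \<Longrightarrow> a \<rhd> b \<in> A0 \<Longrightarrow> b \<in> A0"
    and A0_ract_cancel: "a \<in> T \<Longrightarrow> b \<lhd> a \<in> A0 \<Longrightarrow> b \<in> A0"
    and lact_cancel: "a \<in> T \<Longrightarrow> a \<rhd> b1 = a \<rhd> b2 \<Longrightarrow> b1 = b2"
    and ract_cancel: "a \<in> T \<Longrightarrow> b1 \<lhd> a = b2 \<lhd> a \<Longrightarrow> b1 = b2"

definition spans_additively :: "'a::comm_monoid_add set \<Rightarrow> bool" where
  "spans_additively S \<longleftrightarrow> (\<forall>b. \<exists>xs. set xs \<subseteq> S \<and> b = sum_list xs)"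

text \<open>In the next two definitions \<open>d\<close> is a candidate for the element \<open>1\<close>-dagger of \<open>T\<close>.\<close>

definition is_dagger_one ::
  "'a::comm_monoid_add set \<Rightarrow> 'a \<Rightarrow> ('a \<Rightarrow> 'a \<Rightarrow> 'a) \<Rightarrow> ('a \<Rightarrow> 'a \<Rightarrow> 'a) \<Rightarrow> 'a set \<Rightarrow> 'a \<Rightarrow> bool" where
  "is_dagger_one T one lact ract A0 d \<longleftrightarrow>
     d \<in> T \<and> one + d \<in> A0 \<and> (\<forall>a\<in>T. lact d a \<in> T) \<and> (\<forall>b. lact d b = ract b d)"

definition circ :: "('a::comm_monoid_add \<Rightarrow> 'a \<Rightarrow> 'a) \<Rightarrow> 'a \<Rightarrow> 'a \<Rightarrow> 'a" where
  "circ ract d b = b + ract b d"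

definition property_N ::
  "'a::comm_monoid_add set \<Rightarrow> 'a \<Rightarrow> ('a \<Rightarrow> 'a \<Rightarrow> 'a) \<Rightarrow> ('a \<Rightarrow> 'a \<Rightarrow> 'a) \<Rightarrow> 'a set \<Rightarrow> bool" where
  "property_N T one lact ract A0 \<longleftrightarrow>
     (\<exists>d. is_dagger_one T one lact ract A0 d \<and>
          (\<forall>a1\<in>T. \<forall>a2\<in>T. a1 + a2 \<in> A0 \<longrightarrow> a1 + a2 = circ ract d a1))"

locale metatangible_pair =
  standing_pair T one lact ract A0
  for T :: "'a::comm_monoid_add set" and one :: 'a
    and lact :: "'a \<Rightarrow> 'a \<Rightarrow> 'a"  (infixr "\<rhd>" 75)
    and ract :: "'a \<Rightarrow> 'a \<Rightarrow> 'a"  (infixl "\<lhd>" 75)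
    and A0 :: "'a set" +
  assumes admissible: "spans_additively (insert 0 T)"
    and property_N: "property_N T one lact ract A0"
    and metatangible: "a1 \<in> T \<Longrightarrow> a2 \<in> T \<Longrightarrow> a1 + a2 \<in> T \<union> A0"

definition second_kind :: "'a::comm_monoid_add set \<Rightarrow> 'a set \<Rightarrow> bool" where
  "second_kind T A0 \<longleftrightarrow> (\<forall>a\<in>T. a + a \<notin> A0)"

definition negation_map ::
  "'a::comm_monoid_add set \<Rightarrow> 'a \<Rightarrow> ('a \<Rightarrow> 'a \<Rightarrow> 'a) \<Rightarrow> ('a \<Rightarrow> 'a \<Rightarrow> 'a) \<Rightarrow> 'a set \<Rightarrow> ('a \<Rightarrow> 'a) \<Rightarrow> bool"
where
  "negation_map T one lact ract A0 neg \<longleftrightarrow>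
     bij neg \<and> neg 0 = 0 \<and> (\<forall>b b'. neg (b + b') = neg b + neg b') \<and>
     (\<forall>b. neg (neg b) = b) \<and>
     neg ` T \<subseteq> T \<and>
     one + neg one \<in> A0 \<and>
     (\<forall>a\<in>T. \<forall>b. lact (neg a) b = neg (lact a b) \<and> neg (lact a b) = lact a (neg b)) \<and>
     (\<forall>a\<in>T. \<forall>b. ract (neg b) a = neg (ract b a) \<and> neg (ract b a) = ract b (neg a))"

definition uniquely_negated :: "'a::comm_monoid_add set \<Rightarrow> 'a set \<Rightarrow> ('a \<Rightarrow> 'a) \<Rightarrow> bool" where
  "uniquely_negated T A0 neg \<longleftrightarrow> (\<forall>a\<in>T. \<forall>a'\<in>T. a + a' \<in> A0 \<longrightarrow> a' = neg a)"

definition nabla_neg :: "'a::comm_monoid_add set \<Rightarrow> ('a \<Rightarrow> 'a) \<Rightarrow> 'a \<Rightarrow> 'a \<Rightarrow> bool" where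
  "nabla_neg A0 neg b1 b2 \<longleftrightarrow> b1 + neg b2 \<in> A0"

definition nabla_T :: "'a::comm_monoid_add set \<Rightarrow> 'a set \<Rightarrow> 'a \<Rightarrow> 'a \<Rightarrow> bool" where
  "nabla_T T A0 b1 b2 \<longleftrightarrow>
     (\<exists>(t::nat) b10 b20 a1 a2.
        b10 \<in> A0 \<and> b20 \<in> A0 \<and>
        (\<forall>j\<in>{1..t}. a1 j \<in> T \<and> a2 j \<in> T) \<and>
        b1 = b10 + (\<Sum>j=1..t. a1 j) \<and>
        b2 = b20 + (\<Sum>j=1..t. a2 j) \<and>
        (\<forall>j\<in>{1..t}. \<exists>a\<in>T. a1 j + a \<in> A0 \<and> a2 j + a \<in> A0))"

end

theory Submission
  imports Defs
begin

text \<open>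
  Write \<open>a\<degree>\<close> for \<open>a + (-)a\<close>. The forward direction rests on a complete description of the
  semigroup: in a metatangible pair of the second kind with a negation map, every element is \<open>0\<close>,
  or tangible (in \<open>T\<close>), or of the form \<open>a\<degree>\<close> with \<open>a\<close> tangible.

  Property N says that a sum \<open>a + b\<close> of tangibles lying in \<open>A0\<close> equals \<open>a\<degree>\<close>, and by commutativity
  also \<open>b\<degree>\<close>. So adding a tangible \<open>x\<close> to \<open>d\<degree> = d + (-)d\<close> can be done in two steps, \<open>x + d\<close> and then
  \<open>(x + d) + (-)d\<close>, each of which either stays tangible or collapses to a known \<open>a\<degree>\<close>. If
  \<open>x + d\<close> is itself in \<open>A0\<close>, then \<open>d\<degree> = x\<degree>\<close>, and the sum is \<open>(x + x) + (-)x\<close>, where the second kind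
  makes \<open>x + x\<close> tangible. Admissibility then gives the description by induction on the length of a sum.

  Suppose now that \<open>b1 + (-)b2\<close> is in \<open>A0\<close>. If both \<open>b1\<close> and \<open>b2\<close> are in \<open>A0\<close>, the empty family of
  tangibles witnesses \<open>\<nabla>\<^sub>T\<close>; if both are tangible, a single pair does, with \<open>(-)b2\<close> as
  common quasi-negative. In the mixed case \<open>c \<in> A0\<close>, \<open>a \<in> T\<close>, the same two-step computation shows
  that \<open>c\<close> absorbs \<open>a\<close>, that is \<open>c + a = c\<close>. Hence \<open>c = c + a\<close> and \<open>a = 0 + a\<close> are decompositions
  with the same tangible part.

  Conversely, unique negation forces \<open>a\<^sub>1\<^sub>j = a\<^sub>2\<^sub>j\<close> for each pair in a decomposition witnessing
  \<open>\<nabla>\<^sub>T\<close>, so \<open>b1 + (-)b2\<close> is a sum of elements of \<open>A0\<close> and of elements \<open>a\<degree>\<close>.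
\<close>

locale negated_metatangible_pair =
  metatangible_pair T one lact ract A0
  for T :: "'a::comm_monoid_add set" and one :: 'a
    and lact :: "'a \<Rightarrow> 'a \<Rightarrow> 'a"  (infixr "\<rhd>" 75)
    and ract :: "'a \<Rightarrow> 'a \<Rightarrow> 'a"  (infixl "\<lhd>" 75)
    and A0 :: "'a set" +
  fixes neg :: "'a \<Rightarrow> 'a"
  assumes negation: "negation_map T one lact ract A0 neg"
begin

lemma neg_zero: "neg 0 = 0"
  and neg_add: "neg (b + b') = neg b + neg b'"
  and neg_neg: "neg (neg b) = b"
  and neg_one: "one + neg one \<in> A0"
  using negation by (auto simp: negation_map_def)

lemma neg_in_T: "a \<in> T \<Longrightarrow> neg a \<in> T"
  using negation by (auto simp: negation_map_def)

lemma neg_lact: "a \<in> T \<Longrightarrow> neg a \<rhd> b = neg (a \<rhd> b)"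
  and lact_neg: "a \<in> T \<Longrightarrow> a \<rhd> neg b = neg (a \<rhd> b)"
  using negation by (auto simp: negation_map_def)

text \<open>Negation is the action of the tangible element \<open>(-)1\<close>, and \<open>A0\<close> is a submodule.\<close>

lemma neg_in_A0: "x \<in> A0 \<Longrightarrow> neg x \<in> A0"
  using A0_lact[of "neg one" x] neg_lact[of one x] neg_in_T[of one] one_in_T
  by (simp add: lact_one)

lemma tangible_notin_A0: "a \<in> T \<Longrightarrow> a \<notin> A0"
  using A0_Int_T0 zero_notin_T by (metis IntI insertCI singletonD)

lemma add_neg_in_A0: "a \<in> T \<Longrightarrow> a + neg a \<in> A0"
  using A0_lact[of a "one + neg one"]
  by (simp add: lact_add lact_neg lact_on_one neg_one)

text \<open>
  The quasi-zeros \<open>a + a1\<^sup>\<dagger>\<close> of Property N coincide with \<open>a + (-)a\<close>, because the latter is itself a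
  sum of two tangibles in \<open>A0\<close>. So the dagger can be forgotten.
\<close>

lemma quasi_zero_sum_eq_add_neg:
  assumes "a \<in> T" "b \<in> T" "a + b \<in> A0"
  shows "a + b = a + neg a"
proof -
  obtain d where "\<And>a1 a2. a1 \<in> T \<Longrightarrow> a2 \<in> T \<Longrightarrow> a1 + a2 \<in> A0 \<Longrightarrow> a1 + a2 = circ ract d a1"
    using property_N by (auto simp: property_N_def)
  then show ?thesis
    using assms add_neg_in_A0 neg_in_T by metis
qed

lemma quasi_zero_sum_eq_add_neg':
  assumes "a \<in> T" "b \<in> T" "a + b \<in> A0"
  shows "a + b = b + neg b"
  using quasi_zero_sum_eq_add_neg[of b a] assms by (simp add: add.commute)

lemma nabla_neg_sym:
  assumes "nabla_neg A0 neg b1 b2"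
  shows "nabla_neg A0 neg b2 b1"
  using neg_in_A0[of "b1 + neg b2"] assms
  by (simp add: nabla_neg_def neg_add neg_neg add.commute)

lemma nabla_T_imp_nabla_neg:
  assumes uniq: "uniquely_negated T A0 neg" and nabla: "nabla_T T A0 b1 b2"
  shows "nabla_neg A0 neg b1 b2"
proof -
  from nabla obtain t :: nat and b10 b20 a1 a2 where
    b0: "b10 \<in> A0" "b20 \<in> A0" and
    inT: "\<forall>j\<in>{1..t}. a1 j \<in> T \<and> a2 j \<in> T" and
    b1: "b1 = b10 + (\<Sum>j=1..t. a1 j)" and b2: "b2 = b20 + (\<Sum>j=1..t. a2 j)" and
    common: "\<forall>j\<in>{1..t}. \<exists>a\<in>T. a1 j + a \<in> A0 \<and> a2 j + a \<in> A0"
    unfolding nabla_T_def by blast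
  have eq: "a2 j = a1 j" if j: "j \<in> {1..t}" for j
  proof -
    obtain a where "a \<in> T" "a1 j + a \<in> A0" "a2 j + a \<in> A0"
      using common j by blast
    then have "a = neg (a1 j)" "a = neg (a2 j)"
      using uniq inT j unfolding uniquely_negated_def by blast+
    then show ?thesis by (metis neg_neg)
  qed
  have neg_sum: "neg (sum f S) = (\<Sum>j\<in>S. neg (f j))" for f and S :: "nat set"
    by (induction S rule: infinite_finite_induct) (simp_all add: neg_zero neg_add)
  have sum_in: "(\<Sum>j\<in>S. f j) \<in> A0" if "\<And>j. j \<in> S \<Longrightarrow> f j \<in> A0" for f and S :: "nat set"
    using that by (induction S rule: infinite_finite_induct) (auto intro: A0_zero A0_add)
  have "b1 + neg b2 = (b10 + neg b20) + (\<Sum>j=1..t. a1 j + neg (a1 j))"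
    by (simp add: b1 b2 neg_add neg_sum eq sum.distrib ac_simps)
  also have "\<dots> \<in> A0"
    using inT b0 by (intro A0_add sum_in neg_in_A0 add_neg_in_A0) auto
  finally show ?thesis by (simp add: nabla_neg_def)
qed

lemma nabla_T_of_A0: "b1 \<in> A0 \<Longrightarrow> b2 \<in> A0 \<Longrightarrow> nabla_T T A0 b1 b2"
  unfolding nabla_T_def by (rule exI[of _ 0]) auto

lemma nabla_T_add_tangible:
  assumes "c1 \<in> A0" "c2 \<in> A0" "a1 \<in> T" "a2 \<in> T" "a1 + neg a2 \<in> A0"
  shows "nabla_T T A0 (c1 + a1) (c2 + a2)"
proof -
  have "\<exists>a\<in>T. a1 + a \<in> A0 \<and> a2 + a \<in> A0"
    using assms add_neg_in_A0 neg_in_T by blast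
  then show ?thesis
    unfolding nabla_T_def using assms
    by (intro exI[of _ 1] exI[of _ c1] exI[of _ c2] exI[of _ "\<lambda>_. a1"] exI[of _ "\<lambda>_. a2"]) auto
qed

end

locale second_kind_negated_pair =
  negated_metatangible_pair T one lact ract A0 neg
  for T :: "'a::comm_monoid_add set" and one :: 'a
    and lact :: "'a \<Rightarrow> 'a \<Rightarrow> 'a"  (infixr "\<rhd>" 75)
    and ract :: "'a \<Rightarrow> 'a \<Rightarrow> 'a"  (infixl "\<lhd>" 75)
    and A0 :: "'a set"
    and neg :: "'a \<Rightarrow> 'a" +
  assumes second: "second_kind T A0"
begin

text \<open>
  Both cases use the bracketing \<open>x + (d + (-)d) = (x + d) + (-)d\<close>. If \<open>x + d\<close> is tangible, one more
  application of metatangibility finishes. Otherwise \<open>d + (-)d = x + (-)x\<close>, and \<open>d\<close> may be replaced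
  by \<open>x\<close>, for which \<open>x + x\<close> is tangible.
\<close>

lemma tangible_add_quasi_zero:
  assumes x: "x \<in> T" and d: "d \<in> T"
  shows "x + (d + neg d) \<in> T \<or> x + (d + neg d) = d + neg d"
proof -
  have step: "x + (e + neg e) \<in> T \<or> x + (e + neg e) = e + neg e" if e: "e \<in> T" "x + e \<in> T" for e
  proof (cases "(x + e) + neg e \<in> A0")
    case True
    then have "(x + e) + neg e = neg e + neg (neg e)"
      using quasi_zero_sum_eq_add_neg'[of "x + e" "neg e"] e neg_in_T by blast
    then show ?thesis by (simp add: neg_neg ac_simps)
  next
    case False
    then show ?thesis
      using metatangible[of "x + e" "neg e"] e neg_in_T[of e] by (simp add: add.assoc)
  qed
  show ?thesis
  proof (cases "x + d \<in> A0")
    case True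
    then have eq: "d + neg d = x + neg x"
      using quasi_zero_sum_eq_add_neg[of x d] quasi_zero_sum_eq_add_neg'[of x d] x d by simp
    have "x + x \<in> T"
      using second metatangible[of x x] x by (auto simp: second_kind_def)
    then show ?thesis using step[of x] x by (simp add: eq)
  next
    case False
    then show ?thesis using step[of d] metatangible[of x d] x d by blast
  qed
qed

lemma zero_or_tangible_or_quasi_zero:
  "b = 0 \<or> b \<in> T \<or> (\<exists>d\<in>T. b = d + neg d)"
proof -
  obtain xs where "set xs \<subseteq> insert 0 T" and b: "b = sum_list xs"
    using admissible by (auto simp: spans_additively_def)
  then have "sum_list xs = 0 \<or> sum_list xs \<in> T \<or> (\<exists>d\<in>T. sum_list xs = d + neg d)"
  proof (induction xs arbitrary: b)
    case Nil
    then show ?case by simp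
  next
    case (Cons x xs)
    let ?s = "sum_list xs"
    have IH: "?s = 0 \<or> ?s \<in> T \<or> (\<exists>d\<in>T. ?s = d + neg d)"
      using Cons by simp
    show ?case
    proof (cases "x = 0")
      case True
      then show ?thesis using IH by simp
    next
      case False
      then have x: "x \<in> T" using Cons.prems by simp
      from IH consider "?s = 0" | "?s \<in> T" | d where "d \<in> T" "?s = d + neg d" by blast
      then show ?thesis
      proof cases
        case 1
        then show ?thesis using x by simp
      next
        case 2
        then show ?thesis
          using metatangible[of x ?s] quasi_zero_sum_eq_add_neg[of x ?s] x by auto
      next
        case 3
        then show ?thesis
          using tangible_add_quasi_zero[of x d] x by auto
      qed
    qed
  qed
  then show ?thesis using b by simp
qed

text \<open>
  A nonzero element of \<open>A0\<close> has the form \<open>d + (-)d\<close>, which is fixed by negation. As tangibles avoid \<open>A0\<close>,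
  adding a tangible to it either leaves \<open>A0\<close> or changes nothing.
\<close>

lemma quasi_zero_absorbs:
  assumes c: "c \<in> A0" and a: "a \<in> T" and sum: "c + neg a \<in> A0"
  shows "c + a = c"
proof -
  have na: "neg a \<in> T" "neg a \<notin> A0"
    using a neg_in_T tangible_notin_A0 by blast+
  then have "c \<noteq> 0" using sum by auto
  then obtain d where d: "d \<in> T" "c = d + neg d"
    using zero_or_tangible_or_quasi_zero[of c] c tangible_notin_A0 by blast
  have negc: "neg c = c"
    using add.commute[of "neg d" d] by (simp add: d neg_add neg_neg)
  have "neg a + c \<in> T \<or> neg a + c = c"
    using tangible_add_quasi_zero[OF na(1) d(1)] d(2) by simp
  moreover have "neg a + c \<notin> T"
    using sum tangible_notin_A0 by (metis add.commute)
  ultimately have "neg (neg a + c) = neg c" by simp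
  then show ?thesis by (simp add: neg_add neg_neg negc add.commute)
qed

lemma nabla_neg_imp_nabla_T:
  assumes nabla: "nabla_neg A0 neg b1 b2"
  shows "nabla_T T A0 b1 b2"
proof -
  have dichotomy: "b \<in> A0 \<or> b \<in> T" for b
    using zero_or_tangible_or_quasi_zero[of b] A0_zero add_neg_in_A0 by blast
  have absorb: "c + a = c" if "c \<in> A0" "a \<in> T" "nabla_neg A0 neg c a" for c a
    using quasi_zero_absorbs that by (simp add: nabla_neg_def)
  consider "b1 \<in> A0" "b2 \<in> A0" | "b1 \<in> T" "b2 \<in> T" | "b1 \<in> A0" "b2 \<in> T" | "b1 \<in> T" "b2 \<in> A0"
    using dichotomy by blast
  then show ?thesis
  proof cases
    case 1
    then show ?thesis by (rule nabla_T_of_A0)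
  next
    case 2
    then show ?thesis
      using nabla_T_add_tangible[of 0 0 b1 b2] nabla A0_zero by (simp add: nabla_neg_def)
  next
    case 3
    then show ?thesis
      using nabla_T_add_tangible[of b1 0 b2 b2] absorb nabla A0_zero add_neg_in_A0 by simp
  next
    case 4
    then show ?thesis
      using nabla_T_add_tangible[of 0 b2 b1 b1] absorb nabla_neg_sym[OF nabla] A0_zero add_neg_in_A0
      by simp
  qed
qed

end

theorem theorem2:
  fixes T :: "'a::comm_monoid_add set" and one :: 'a
    and lact ract :: "'a \<Rightarrow> 'a \<Rightarrow> 'a" and A0 :: "'a set"
    and neg :: "'a \<Rightarrow> 'a" and b1 b2 :: 'a
  assumes "metatangible_pair T one lact ract A0"
    and "second_kind T A0"
    and "negation_map T one lact ract A0 neg"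
  shows "(nabla_neg A0 neg b1 b2 \<longrightarrow> nabla_T T A0 b1 b2) \<and>
         (uniquely_negated T A0 neg \<longrightarrow> nabla_T T A0 b1 b2 \<longrightarrow> nabla_neg A0 neg b1 b2)"
proof -
  interpret second_kind_negated_pair T one lact ract A0 neg
    using assms
    by (simp add: second_kind_negated_pair_def second_kind_negated_pair_axioms_def
        negated_metatangible_pair_def negated_metatangible_pair_axioms_def)
  show ?thesis
    using nabla_neg_imp_nabla_T nabla_T_imp_nabla_neg by blast
qed

end
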